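(* Let $X$ be any finite dimensional Banach space whose unit ball is a polytope. Then $\mathcal A(X,c)=(0,1]$.
   Context: $c$ denotes the space of all real converging sequences, equipped with the supremum norm. For metric spaces $(X,d)$, $(Y,\varrho)$, $\alpha\in(0,1]$ and $K>0$, a map $f:X\to Y$ is called $(K,\alpha)$-Hölder if $\varrho(f(x),f(y))\le K d(x,y)^\alpha$ for all $x,y\in X$. $\mathcal A(X,Y)$ denotes the set of all $\alpha\in(0,1]$ such that for every $K>0$ and every subset $M\subset X$, any $(K,\alpha)$-Hölder function $f:M\to Y$ can be extended to a $(K,\alpha)$-Hölder function from $X$ into $Y$ (same constant $K$). Normed spaces are viewed as metric spaces with the norm distance. *)

theory Defs
  imports "HOL-Analysis.Analysis"
begin

text \<open>
  Bounded real sequences are the elements of \<^typ>\<open>nat \<Rightarrow>\<^sub>C real\<close> (the topology of \<^typ>\<open>nat\<close> is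
  discrete), whose library norm and distance are the supremum ones. The space \<open>c\<close> is the
  subspace of convergent sequences; since these are bounded, none is lost.
\<close>

definition c_space :: "(nat \<Rightarrow>\<^sub>C real) set"
  where "c_space = {s. convergent (apply_bcontfun s)}"

lemma range_c_space: "apply_bcontfun ` c_space = {s :: nat \<Rightarrow> real. convergent s}"
proof -
  have "s \<in> apply_bcontfun ` c_space" if "convergent s" for s :: "nat \<Rightarrow> real"
  proof -
    have "s \<in> bcontfun"
      using convergent_imp_bounded [of s] that
      by (auto simp: bcontfun_def convergent_def)
    then show ?thesis
      using that by (auto simp: c_space_def image_iff intro!: exI [of _ "Bcontfun s"]
          simp: Bcontfun_inverse)
  qed
  then show ?thesis by (auto simp: c_space_def)
qed

lemma norm_c_space: "norm (s :: nat \<Rightarrow>\<^sub>C real) = (SUP n. \<bar>s n\<bar>)"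
  by (simp add: norm_bcontfun_def dist_bcontfun_def)

lemma subspace_c_space: "subspace c_space"
proof -
  have "apply_bcontfun (0 :: nat \<Rightarrow>\<^sub>C real) = (\<lambda>_. 0)"
    by auto
  moreover have "apply_bcontfun (s + t) = (\<lambda>n. s n + t n)" for s t :: "nat \<Rightarrow>\<^sub>C real"
    by (auto simp: fun_eq_iff)
  moreover have "apply_bcontfun (a *\<^sub>R s) = (\<lambda>n. a * s n)" for a and s :: "nat \<Rightarrow>\<^sub>C real"
    by (auto simp: fun_eq_iff)
  ultimately show ?thesis
    by (auto simp: subspace_def c_space_def
        intro: convergent_const convergent_add convergent_mult)
qed

text \<open>
  Metric spaces are given as subsets of an ambient metric space with the induced distance.
  Values outside the domain \<open>M\<close> are irrelevant. Note \<open>0 powr \<alpha> = 0\<close>, as required at \<open>x = y\<close>.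
\<close>

definition holder_map ::
    "real \<Rightarrow> real \<Rightarrow> 'a::metric_space set \<Rightarrow> 'b::metric_space set \<Rightarrow> ('a \<Rightarrow> 'b) \<Rightarrow> bool"
  where "holder_map K \<alpha> M Y f \<longleftrightarrow>
    f \<in> M \<rightarrow> Y \<and> (\<forall>x\<in>M. \<forall>y\<in>M. dist (f x) (f y) \<le> K * dist x y powr \<alpha>)"

definition holder_ext_exponents ::
    "'a::metric_space set \<Rightarrow> 'b::metric_space set \<Rightarrow> real set"
  where "holder_ext_exponents X Y =
    {\<alpha> \<in> {0<..1}. \<forall>K>0. \<forall>M\<subseteq>X. \<forall>f. holder_map K \<alpha> M Y f \<longrightarrow>
       (\<exists>g. holder_map K \<alpha> X Y g \<and> (\<forall>x\<in>M. g x = f x))}"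

end

theory Submission
  imports Defs
begin

text \<open>
  By Zorn's lemma it suffices to extend a map into \<open>c\<close>, \<open>1\<close>-Lipschitz for
  \<open>\<rho> x y = K * dist x y powr \<alpha>\<close>, to one more point \<open>x\<close>. The admissible values of its \<open>n\<close>-th
  coordinate at \<open>x\<close> form an interval \<open>[L n, U n]\<close>, and a convergent choice exists once
  \<open>limsup L \<le> liminf U\<close>. This holds provided that every sequence \<open>a\<close> has a subsequence which is
  asymptotically collinear with \<open>x\<close> (\<open>\<rho> x (a N) + \<rho> (a N) (a n) \<le> \<rho> x (a n) + \<delta>\<close> for some \<open>N\<close>
  and all large \<open>n\<close>), or along which all points \<open>y\<close> satisfy \<open>\<rho> y (a n) \<le> \<rho> x (a n) + \<delta>\<close>
  eventually.

  If the unit ball is the convex hull of a finite set \<open>V\<close>, then \<open>a n - x\<close> is a nonnegative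
  combination of \<open>V\<close> whose coefficients add up to its norm. On a subsequence every coefficient
  converges or tends to infinity, so it hardly decreases any more, and the norm is nearly
  additive along the subsequence. This settles \<open>\<alpha> = 1\<close>, as well as bounded sequences for
  \<open>\<alpha> < 1\<close>; for unbounded ones the second alternative holds because \<open>t powr \<alpha>\<close> has derivative
  tending to \<open>0\<close>.
\<close>

section \<open>Extension to the whole space by Zorn's lemma\<close>

text \<open>Zorn's lemma is applied to graphs ordered by inclusion, where unions bound chains. A
  maximal graph has full domain, since \<open>one_point\<close> would otherwise supply a further
  pair.\<close>

lemma lipschitz_graph_extension:
  fixes \<rho> :: "'a \<Rightarrow> 'a \<Rightarrow> real" and Y :: "'b::metric_space set"
  assumes \<rho>_self: "\<And>x. \<rho> x x = 0" and \<rho>_sym: "\<And>x y. \<rho> x y = \<rho> y x"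
    and one_point: "\<And>M (f :: 'a \<Rightarrow> 'b) x. f \<in> M \<rightarrow> Y \<Longrightarrow>
      \<forall>x\<in>M. \<forall>y\<in>M. dist (f x) (f y) \<le> \<rho> x y \<Longrightarrow> \<exists>s\<in>Y. \<forall>y\<in>M. dist s (f y) \<le> \<rho> x y"
    and f: "f \<in> M \<rightarrow> Y" "\<forall>x\<in>M. \<forall>y\<in>M. dist (f x) (f y) \<le> \<rho> x y"
  obtains g where "range g \<subseteq> Y" "\<And>x y. dist (g x) (g y) \<le> \<rho> x y" "\<And>x. x \<in> M \<Longrightarrow> g x = f x"
proof -
  \<comment> \<open>Graphs are plain relations; that they are single-valued follows from the
    distance bound and \<open>\<rho> x x = 0\<close>.\<close>
  define valid where "valid G \<longleftrightarrow> (\<lambda>x. (x, f x)) ` M \<subseteq> G \<and> G \<subseteq> UNIV \<times> Y \<and>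
    (\<forall>(x, s)\<in>G. \<forall>(y, t)\<in>G. dist s t \<le> \<rho> x y)" for G
  have "valid ((\<lambda>x. (x, f x)) ` M)"
    using f by (auto simp: valid_def)
  moreover have "valid (\<Union>C)" if "C \<noteq> {}" "subset.chain {G. valid G} C" for C
  proof -
    have valid: "valid G" if "G \<in> C" for G
      using \<open>subset.chain {G. valid G} C\<close> that by (auto simp: subset.chain_def)
    have "dist s t \<le> \<rho> x y" if union: "(x, s) \<in> \<Union>C" "(y, t) \<in> \<Union>C" for x y s t
    proof -
      obtain G H where GH: "G \<in> C" "H \<in> C" "(x, s) \<in> G" "(y, t) \<in> H"
        using union by auto
      then have "G \<subseteq> H \<or> H \<subseteq> G"
        using \<open>subset.chain {G. valid G} C\<close> by (auto simp: subset_chain_def)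
      then obtain I where "I \<in> C" "(x, s) \<in> I" "(y, t) \<in> I"
        using GH by blast
      then show ?thesis
        using valid by (fastforce simp: valid_def)
    qed
    then have "\<forall>(x, s)\<in>\<Union>C. \<forall>(y, t)\<in>\<Union>C. dist s t \<le> \<rho> x y"
      by blast
    moreover have "(\<lambda>x. (x, f x)) ` M \<subseteq> \<Union>C" "\<Union>C \<subseteq> UNIV \<times> Y"
      using \<open>C \<noteq> {}\<close> valid unfolding valid_def by blast+
    ultimately show ?thesis
      unfolding valid_def by blast
  qed
  ultimately obtain G where G: "valid G" and max: "\<And>H. valid H \<Longrightarrow> G \<subseteq> H \<Longrightarrow> H = G"
    using subset_Zorn_nonempty[of "{G. valid G}"] by auto
  have G_Y: "s \<in> Y" if "(x, s) \<in> G" for x s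
    using G that by (auto simp: valid_def)
  have G_dist: "dist s t \<le> \<rho> x y" if "(x, s) \<in> G" "(y, t) \<in> G" for x y s t
    using G that by (fastforce simp: valid_def)
  have unique: "s = t" if "(x, s) \<in> G" "(x, t) \<in> G" for x s t
    using G_dist[OF that] \<rho>_self[of x] by simp
  define g where "g x = (SOME s. (x, s) \<in> G)" for x
  have g_dom: "(x, g x) \<in> G" if "x \<in> Domain G" for x
    using that unfolding g_def by (auto intro: someI)
  have "x \<in> Domain G" for x
  proof -
    obtain s where s: "s \<in> Y" "\<forall>y\<in>Domain G. dist s (g y) \<le> \<rho> x y"
      using one_point[of g "Domain G" x] g_dom G_Y G_dist by blast
    have "dist s t \<le> \<rho> x y" if "(y, t) \<in> G" for y t
      using s(2) that g_dom unique by (metis Domain.DomainI)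
    then have "valid (insert (x, s) G)"
      using G s(1) G_dist \<rho>_self \<rho>_sym
      by (auto simp: valid_def dist_commute)
    then show ?thesis
      using max[of "insert (x, s) G"] by auto
  qed
  then have g: "(x, g x) \<in> G" for x
    using g_dom by blast
  show thesis
  proof
    show "g x = f x" if "x \<in> M" for x
      using G that unique[OF g] by (auto simp: valid_def)
  qed (use g G_Y G_dist in auto)
qed

section \<open>One-point extension with values in \<open>c\<close>\<close>

text \<open>Isolates what the extension argument uses of \<open>K * dist x y powr \<alpha>\<close>:
  a pseudometric with the subsequence dichotomy. The index \<open>N\<close> refers to
  \<open>a\<close> itself, so \<open>a N\<close> may be any term of the sequence.\<close>

locale collinear_sequences =
  fixes \<rho> :: "'a \<Rightarrow> 'a \<Rightarrow> real"
  assumes self: "\<rho> x x = 0"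
    and sym: "\<rho> x y = \<rho> y x"
    and triangle: "\<rho> x z \<le> \<rho> x y + \<rho> y z"
    and collinear: "\<delta> > 0 \<Longrightarrow> \<exists>r :: nat \<Rightarrow> nat. strict_mono r \<and>
      ((\<exists>N. \<forall>\<^sub>F n in sequentially. \<rho> x (a N) + \<rho> (a N) (a (r n)) \<le> \<rho> x (a (r n)) + \<delta>) \<or>
       (\<forall>y. \<forall>\<^sub>F n in sequentially. \<rho> y (a (r n)) \<le> \<rho> x (a (r n)) + \<delta>))"
begin

lemma nonneg: "0 \<le> \<rho> x y"
  using triangle[of x x y] self[of x] sym[of x y] by simp

text \<open>
  The two alternatives of the conclusion are incompatible with the ones obtained for \<open>- f\<close> and
  \<open>- t\<close>: this is how \<open>limsup L > liminf U\<close> is excluded below.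
\<close>

lemma frequently_lower_bound:
  fixes f :: "nat \<Rightarrow> 'a \<Rightarrow> real"
  assumes lip: "\<And>n x y. x \<in> M \<Longrightarrow> y \<in> M \<Longrightarrow> f n x - f n y \<le> \<rho> x y"
    and lim: "\<And>y. y \<in> M \<Longrightarrow> (\<lambda>n. f n y) \<longlonglongrightarrow> F y"
    and freq: "\<exists>\<^sub>F n in sequentially. \<exists>a\<in>M. t + \<epsilon> + \<rho> x a < f n a" and "\<epsilon> > 0"
  shows "(\<exists>y\<in>M. t + \<rho> x y < F y) \<or> (\<forall>y\<in>M. t < F y)"
proof -
  have "infinite {n. \<exists>a\<in>M. t + \<epsilon> + \<rho> x a < f n a}"
    using freq by (simp add: frequently_cofinite flip: cofinite_eq_sequentially)
  then obtain q :: "nat \<Rightarrow> nat" where q: "strict_mono q" "\<And>n. \<exists>a\<in>M. t + \<epsilon> + \<rho> x a < f (q n) a"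
    using infinite_enumerate by blast
  then obtain a where a: "\<And>n. a n \<in> M" "\<And>n. t + \<epsilon> + \<rho> x (a n) < f (q n) (a n)"
    by metis
  obtain r where r: "strict_mono r" and
    cases: "(\<exists>N. \<forall>\<^sub>F n in sequentially. \<rho> x (a N) + \<rho> (a N) (a (r n)) \<le> \<rho> x (a (r n)) + \<epsilon> / 2) \<or>
       (\<forall>y. \<forall>\<^sub>F n in sequentially. \<rho> y (a (r n)) \<le> \<rho> x (a (r n)) + \<epsilon> / 2)"
    using collinear[of "\<epsilon> / 2" x a] \<open>\<epsilon> > 0\<close> by auto
  \<comment> \<open>The Lipschitz bound between \<open>a (r n)\<close> and \<open>y\<close> carries
    the lower bound at \<open>a (r n)\<close> over to \<open>y\<close>. Half of
    \<open>\<epsilon>\<close> pays for the error in the dichotomy, the other half keeps the limit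
    inequality strict. The alternatives use \<open>b = \<rho> x (a N)\<close> with
    \<open>y = a N\<close>, and \<open>b = 0\<close>.\<close>
  have limit: "t + b < F y"
    if "y \<in> M" and ev: "\<forall>\<^sub>F n in sequentially. b + \<rho> y (a (r n)) \<le> \<rho> x (a (r n)) + \<epsilon> / 2" for y b
  proof -
    have "(\<lambda>n. f (q (r n)) y) \<longlonglongrightarrow> F y"
      using LIMSEQ_subseq_LIMSEQ[OF lim[OF \<open>y \<in> M\<close>] strict_mono_o[OF q(1) r]] by (simp add: o_def)
    moreover have "\<forall>\<^sub>F n in sequentially. t + b + \<epsilon> / 2 \<le> f (q (r n)) y"
      using ev
    proof eventually_elim
      case (elim n)
      then show ?case
        using a(2)[of "r n"] lip[OF a(1)[of "r n"] \<open>y \<in> M\<close>, of "q (r n)"] sym[of y "a (r n)"]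
        by linarith
    qed
    ultimately have "t + b + \<epsilon> / 2 \<le> F y"
      by (rule tendsto_lowerbound) simp
    with \<open>\<epsilon> > 0\<close> show ?thesis by linarith
  qed
  from cases show ?thesis
  proof
    assume "\<exists>N. \<forall>\<^sub>F n in sequentially. \<rho> x (a N) + \<rho> (a N) (a (r n)) \<le> \<rho> x (a (r n)) + \<epsilon> / 2"
    then obtain N where "t + \<rho> x (a N) < F (a N)"
      using limit[OF a(1), of "\<rho> x (a N)" N for N] by metis
    then show ?thesis
      using a(1) by blast
  next
    assume "\<forall>y. \<forall>\<^sub>F n in sequentially. \<rho> y (a (r n)) \<le> \<rho> x (a (r n)) + \<epsilon> / 2"
    then show ?thesis
      using limit[where b = 0] by simp
  qed
qed

text \<open>\<open>L\<close> and \<open>U\<close> are the smallest and largest McShane-Whitney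
  extensions, coordinate by coordinate. The new sequence is the constant \<open>c = limsup L\<close>
  clipped to \<open>[L n, U n]\<close>; it converges to \<open>c\<close> because
  \<open>c \<le> liminf U\<close>.\<close>

lemma one_point_extension:
  fixes f :: "nat \<Rightarrow> 'a \<Rightarrow> real"
  assumes lip: "\<And>n x y. x \<in> M \<Longrightarrow> y \<in> M \<Longrightarrow> f n x - f n y \<le> \<rho> x y"
    and conv: "\<And>y. y \<in> M \<Longrightarrow> convergent (\<lambda>n. f n y)"
  shows "\<exists>s. convergent s \<and> (\<forall>n. \<forall>y\<in>M. \<bar>s n - f n y\<bar> \<le> \<rho> x y)"
proof (cases "M = {}")
  case True
  then show ?thesis
    using convergent_const by auto
next
  case False
  then obtain y0 where y0: "y0 \<in> M" by auto
  obtain F where lim: "\<And>y. y \<in> M \<Longrightarrow> (\<lambda>n. f n y) \<longlonglongrightarrow> F y"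
    using conv unfolding convergent_def by metis
  define L where "L n = (SUP y\<in>M. f n y - \<rho> x y)" for n
  define U where "U n = (INF y\<in>M. f n y + \<rho> x y)" for n
  have le: "f n y - \<rho> x y \<le> f n z + \<rho> x z" if "y \<in> M" "z \<in> M" for n y z
    using lip[OF that, of n] triangle[of y z x] sym[of x y] by linarith
  have bdd: "bdd_above ((\<lambda>y. f n y - \<rho> x y) ` M)" "bdd_below ((\<lambda>y. f n y + \<rho> x y) ` M)" for n
    using le y0 by (meson bdd_aboveI2, meson bdd_belowI2)
  have L_ge: "f n y - \<rho> x y \<le> L n" and U_le: "U n \<le> f n y + \<rho> x y" if "y \<in> M" for n y
    unfolding L_def U_def using bdd that by (auto intro: cSUP_upper cINF_lower)
  have L_le: "L n \<le> f n y + \<rho> x y" if "y \<in> M" for n y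
    unfolding L_def using False le that by (intro cSUP_least) auto
  have L_le_U: "L n \<le> U n" for n
    unfolding U_def using False L_le by (intro cINF_greatest) auto
  \<comment> \<open>\<open>Inf T\<close> is the limsup of \<open>L\<close>; the bounds at
    \<open>y0\<close> make \<open>T\<close> nonempty and bounded below, so this is a real
    number.\<close>
  define T where "T = {t. \<forall>\<^sub>F n in sequentially. L n \<le> t}"
  obtain B where B: "\<And>n. \<bar>f n y0\<bar> \<le> B"
    using conv[OF y0, THEN convergent_imp_Bseq] by (auto simp: Bseq_def)
  have "L n \<le> B + \<rho> x y0" for n
    using L_le[OF y0, of n] B[of n] by linarith
  then have T_ne: "T \<noteq> {}"
    unfolding T_def by (auto intro!: exI[of _ "B + \<rho> x y0"])
  have L_lower: "- B - \<rho> x y0 \<le> L n" for n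
    using L_ge[OF y0, of n] B[of n] by linarith
  have "- B - \<rho> x y0 \<le> t" if "t \<in> T" for t
  proof -
    have "\<forall>\<^sub>F n in sequentially. - B - \<rho> x y0 \<le> t"
      using that unfolding T_def mem_Collect_eq
      by (rule eventually_mono) (use L_lower in \<open>meson order_trans\<close>)
    then show ?thesis by simp
  qed
  then have T_bdd: "bdd_below T" by (rule bdd_belowI)
  define c where "c = Inf T"
  have L_upper: "\<forall>\<^sub>F n in sequentially. L n < c + e" if "e > 0" for e
  proof -
    obtain t where "t \<in> T" "t < c + e"
      using cInf_lessD[OF T_ne, of "c + e"] \<open>e > 0\<close> unfolding c_def by auto
    then show ?thesis
      unfolding T_def by (auto elim: eventually_mono)
  qed
  have L_freq: "\<exists>\<^sub>F n in sequentially. c - e < L n" if "e > 0" for e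
  proof (rule ccontr)
    assume "\<not> (\<exists>\<^sub>F n in sequentially. c - e < L n)"
    then have "c - e \<in> T"
      by (simp add: T_def not_frequently not_less)
    then have "c \<le> c - e"
      unfolding c_def using T_bdd by (rule cInf_lower)
    with that show False by simp
  qed
  have U_lower: "\<forall>\<^sub>F n in sequentially. c - e < U n" if "e > 0" for e
  proof (rule ccontr)
    assume contr: "\<not> (\<forall>\<^sub>F n in sequentially. c - e < U n)"
    \<comment> \<open>The midpoint of \<open>c - e\<close> and \<open>c\<close>: infinitely often
      \<open>L n > t + e / 4\<close>, and infinitely often \<open>U n < t - e / 4\<close>. So
      \<open>frequently_lower_bound\<close> applies with margin \<open>e / 4\<close> to
      \<open>f\<close> at level \<open>t\<close> and to \<open>- f\<close> at level
      \<open>- t\<close>.\<close>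
    define t where "t = c - e / 2"
    have "\<exists>\<^sub>F n in sequentially. c - e / 4 < L n"
      using L_freq \<open>e > 0\<close> by simp
    then have "\<exists>\<^sub>F n in sequentially. \<exists>a\<in>M. t + e / 4 + \<rho> x a < f n a"
    proof (rule frequently_elim1)
      fix n assume "c - e / 4 < L n"
      then obtain a where "a \<in> M" "c - e / 4 < f n a - \<rho> x a"
        unfolding L_def less_cSUP_iff[OF False bdd(1)] by auto
      then show "\<exists>a\<in>M. t + e / 4 + \<rho> x a < f n a"
        by (auto simp: t_def intro!: bexI[of _ a])
    qed
    then have up: "(\<exists>y\<in>M. t + \<rho> x y < F y) \<or> (\<forall>y\<in>M. t < F y)"
      using frequently_lower_bound[OF lip lim, of M t "e / 4" x] \<open>e > 0\<close> by simp
    have "\<exists>\<^sub>F n in sequentially. U n \<le> c - e"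
      using contr by (simp add: not_eventually not_less)
    then have freq: "\<exists>\<^sub>F n in sequentially. \<exists>a\<in>M. - t + e / 4 + \<rho> x a < - f n a"
    proof (rule frequently_elim1)
      fix n assume "U n \<le> c - e"
      then have "U n < c - 3 / 4 * e" using \<open>e > 0\<close> by simp
      then obtain a where "a \<in> M" "f n a + \<rho> x a < c - 3 / 4 * e"
        unfolding U_def cINF_less_iff[OF False bdd(2)] by auto
      then show "\<exists>a\<in>M. - t + e / 4 + \<rho> x a < - f n a"
        by (auto simp: t_def field_simps intro!: bexI[of _ a])
    qed
    have down: "(\<exists>y\<in>M. - t + \<rho> x y < - F y) \<or> (\<forall>y\<in>M. - t < - F y)"
    proof (rule frequently_lower_bound[OF _ _ freq])
      show "- f n u - - f n v \<le> \<rho> u v" if "u \<in> M" "v \<in> M" for n u v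
        using lip[OF that(2,1), of n] sym[of u v] by simp
    qed (use lim \<open>e > 0\<close> in \<open>auto intro: tendsto_minus\<close>)
    have F_lip: "F u - F v \<le> \<rho> u v" if "u \<in> M" "v \<in> M" for u v
      using lip that by (intro tendsto_upperbound[OF tendsto_diff[OF lim lim]]) auto
    \<comment> \<open>This excludes the two existential alternatives together. The mixed cases
      contradict \<open>nonneg\<close>, and the two universal ones clash at
      \<open>y0\<close>.\<close>
    have "F u \<le> t + \<rho> x u \<or> t \<le> F v + \<rho> x v" if "u \<in> M" "v \<in> M" for u v
      using F_lip[OF that] triangle[of u v x] sym[of x u] by linarith
    moreover have "0 \<le> \<rho> x u" for u
      by (rule nonneg)
    ultimately show False
      using up down y0 by (smt (verit))
  qed
  \<comment> \<open>Clipping moves \<open>c\<close> by less than \<open>e\<close> as soon as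
    \<open>L n < c + e\<close> and \<open>c - e < U n\<close>.\<close>
  define s where "s n = max (L n) (min c (U n))" for n
  have "s \<longlonglongrightarrow> c"
  proof (rule tendstoI)
    fix e :: real assume "e > 0"
    show "\<forall>\<^sub>F n in sequentially. dist (s n) c < e"
      using L_upper[OF \<open>e > 0\<close>] U_lower[OF \<open>e > 0\<close>]
      by eventually_elim (auto simp: s_def dist_real_def max_def min_def \<open>e > 0\<close>)
  qed
  moreover have "\<bar>s n - f n y\<bar> \<le> \<rho> x y" if "y \<in> M" for n y
    using L_ge[OF that, of n] U_le[OF that, of n] L_le_U[of n]
    unfolding s_def by linarith
  ultimately show ?thesis
    by (auto simp: convergent_def)
qed

text \<open>A bound on the supremum distance is the same bound on every coordinate, so
  \<open>one_point_extension\<close> provides the one-point step of the Zorn argument.\<close>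

lemma c_space_extension:
  fixes f :: "'a \<Rightarrow> nat \<Rightarrow>\<^sub>C real"
  assumes "f \<in> M \<rightarrow> c_space" "\<forall>x\<in>M. \<forall>y\<in>M. dist (f x) (f y) \<le> \<rho> x y"
  obtains g where "range g \<subseteq> c_space" "\<And>x y. dist (g x) (g y) \<le> \<rho> x y"
    "\<And>x. x \<in> M \<Longrightarrow> g x = f x"
proof (rule lipschitz_graph_extension[OF self sym _ assms])
  fix M and f :: "'a \<Rightarrow> nat \<Rightarrow>\<^sub>C real" and x
  assume f: "f \<in> M \<rightarrow> c_space" and lip: "\<forall>x\<in>M. \<forall>y\<in>M. dist (f x) (f y) \<le> \<rho> x y"
  have "f u n - f v n \<le> \<rho> u v" if "u \<in> M" "v \<in> M" for u v n
    using dist_bounded[of "f u" n "f v"] lip that by (force simp: dist_real_def)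
  moreover have "convergent (\<lambda>n. f y n)" if "y \<in> M" for y
    using f that by (auto simp: c_space_def)
  ultimately obtain s where s: "convergent s" "\<And>n y. y \<in> M \<Longrightarrow> \<bar>s n - f y n\<bar> \<le> \<rho> x y"
    using one_point_extension[of M "\<lambda>n y. f y n" x] by blast
  obtain s' where s': "s' \<in> c_space" "s = apply_bcontfun s'"
    using s(1) range_c_space by auto
  have "dist s' (f y) \<le> \<rho> x y" if "y \<in> M" for y
    using s(2)[OF that] s'(2) by (intro dist_bound) (auto simp: dist_real_def)
  with s' show "\<exists>s\<in>c_space. \<forall>y\<in>M. dist s (f y) \<le> \<rho> x y"
    by blast
qed (use that in blast)

end

section \<open>Subsequences of nonnegative sequences\<close>

text \<open>Take a monotone subsequence. If it is unbounded, it must increase, because a decreasing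
  one would stay between \<open>0\<close> and its first term.\<close>

lemma convergent_or_at_top_subseq:
  fixes h :: "nat \<Rightarrow> real"
  assumes "\<And>n. 0 \<le> h n"
  obtains r :: "nat \<Rightarrow> nat"
  where "strict_mono r" "convergent (h \<circ> r) \<or> filterlim (h \<circ> r) at_top sequentially"
proof -
  obtain r where r: "strict_mono r" "monoseq (h \<circ> r)"
    using seq_monosub[of h] by (auto simp: o_def)
  show thesis
  proof (cases "Bseq (h \<circ> r)")
    case True
    then show ?thesis
      using r that Bseq_monoseq_convergent by blast
  next
    case False
    have "incseq (h \<circ> r)"
    proof (rule ccontr)
      assume "\<not> incseq (h \<circ> r)"
      then have "decseq (h \<circ> r)" using r(2) by (simp add: monoseq_iff)
      then have "Bseq (h \<circ> r)"
        using assms by (intro decseq_bounded[where B = 0]) auto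
      with False show False by simp
    qed
    moreover have "\<not> bdd_above (range (h \<circ> r))"
    proof
      assume "bdd_above (range (h \<circ> r))"
      then obtain B where "\<And>n. h (r n) \<le> B" by (auto simp: bdd_above_def)
      then have "Bseq (h \<circ> r)"
        using assms by (intro BseqI'[where K = B]) (auto simp: abs_of_nonneg)
      with False show False by simp
    qed
    ultimately have "filterlim (h \<circ> r) at_top sequentially"
      by (auto simp: filterlim_at_top eventually_sequentially bdd_above_def not_le incseq_def)
        (meson order_trans less_imp_le)
    then show ?thesis using r that by blast
  qed
qed

text \<open>Refine once per index; both alternatives survive passing to a subsequence.\<close>

lemma convergent_or_at_top_subseq_finite:
  fixes h :: "'i \<Rightarrow> nat \<Rightarrow> real"
  assumes "finite I" "\<And>i n. i \<in> I \<Longrightarrow> 0 \<le> h i n"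
  obtains r :: "nat \<Rightarrow> nat" where "strict_mono r"
    "\<And>i. i \<in> I \<Longrightarrow> convergent (h i \<circ> r) \<or> filterlim (h i \<circ> r) at_top sequentially"
proof -
  have "\<exists>r :: nat \<Rightarrow> nat. strict_mono r \<and>
    (\<forall>i\<in>I. convergent (h i \<circ> r) \<or> filterlim (h i \<circ> r) at_top sequentially)"
    using assms
  proof (induction I rule: finite_induct)
    case empty
    then show ?case using strict_mono_id by auto
  next
    case (insert j I)
    then obtain r :: "nat \<Rightarrow> nat" where r: "strict_mono r"
      "\<And>i. i \<in> I \<Longrightarrow> convergent (h i \<circ> r) \<or> filterlim (h i \<circ> r) at_top sequentially"
      by blast
    obtain q :: "nat \<Rightarrow> nat" where q: "strict_mono q"
      "convergent (h j \<circ> r \<circ> q) \<or> filterlim (h j \<circ> r \<circ> q) at_top sequentially"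
      using convergent_or_at_top_subseq[of "h j \<circ> r"] insert.prems by auto
    have "convergent (h i \<circ> (r \<circ> q)) \<or> filterlim (h i \<circ> (r \<circ> q)) at_top sequentially" if "i \<in> I" for i
      using r(2)[OF that] convergent_subseq_convergent[OF _ q(1)]
        filterlim_compose[OF _ filterlim_subseq[OF q(1)], of "h i \<circ> r" at_top]
      by (auto simp: o_def)
    then show ?case
      using q strict_mono_o[OF r(1) q(1)] by (intro exI[of _ "r \<circ> q"]) (simp add: o_def)
  qed
  then show thesis using that by blast
qed

text \<open>Terms near a limit differ by little, and a sequence tending to infinity finally exceeds
  each of its terms. The threshold for \<open>n\<close> may depend on \<open>N\<close>.\<close>

lemma eventually_almost_increasing:
  fixes h :: "nat \<Rightarrow> real"
  assumes "convergent h \<or> filterlim h at_top sequentially" "\<delta> > 0"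
  shows "\<forall>\<^sub>F N in sequentially. \<forall>\<^sub>F n in sequentially. h N - \<delta> \<le> h n"
  using assms(1)
proof
  assume "convergent h"
  then obtain l where l: "h \<longlonglongrightarrow> l" by (auto simp: convergent_def)
  have "\<forall>\<^sub>F n in sequentially. h n < l + \<delta> / 2" "\<forall>\<^sub>F n in sequentially. l - \<delta> / 2 < h n"
    using order_tendstoD[OF l] \<open>\<delta> > 0\<close> by auto
  from this(1) show ?thesis
  proof eventually_elim
    case (elim N)
    from \<open>\<forall>\<^sub>F n in sequentially. l - \<delta> / 2 < h n\<close> show ?case
      by eventually_elim (use elim in simp)
  qed
next
  assume "filterlim h at_top sequentially"
  then show ?thesis
    by (auto simp: filterlim_at_top)
qed

section \<open>Norms whose unit ball is a polytope\<close>

text \<open>Write \<open>sgn a\<close> as a convex combination of \<open>V\<close> and multiply by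
  \<open>norm a\<close>. For \<open>a = 0\<close> all coefficients become \<open>0\<close>.\<close>

lemma norm_representation_polytope:
  fixes a :: "'a::real_normed_vector"
  assumes "finite V" "cball 0 1 = convex hull V"
  obtains c where "\<And>v. v \<in> V \<Longrightarrow> 0 \<le> c v" "(\<Sum>v\<in>V. c v) = norm a" "(\<Sum>v\<in>V. c v *\<^sub>R v) = a"
proof -
  have "sgn a \<in> convex hull V"
    using assms(2) by (auto simp: norm_sgn simp flip: assms(2))
  then obtain u where u: "\<And>v. v \<in> V \<Longrightarrow> 0 \<le> u v" "sum u V = 1" "(\<Sum>v\<in>V. u v *\<^sub>R v) = sgn a"
    using convex_hull_finite[OF assms(1)] by auto
  show thesis
  proof (rule that[of "\<lambda>v. norm a * u v"])
    have "(\<Sum>v\<in>V. (norm a * u v) *\<^sub>R v) = norm a *\<^sub>R sgn a"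
      unfolding u(3)[symmetric] by (simp add: scaleR_sum_right)
    also have "\<dots> = a"
      by (cases "a = 0") (auto simp: sgn_div_norm)
    finally show "(\<Sum>v\<in>V. (norm a * u v) *\<^sub>R v) = a" .
  qed (use u in \<open>auto simp flip: sum_distrib_left\<close>)
qed

text \<open>The norm is the sum of the coefficients. Once these hardly decrease, the sum of the
  absolute increments, which bounds the norm of the difference, is close to the increment of the
  norm.\<close>

lemma polytope_norm_collinear:
  fixes a :: "nat \<Rightarrow> 'a::real_normed_vector"
  assumes "polytope (cball (0 :: 'a) 1)"
  obtains r :: "nat \<Rightarrow> nat" where "strict_mono r"
    "convergent (\<lambda>n. norm (a (r n))) \<or> filterlim (\<lambda>n. norm (a (r n))) at_top sequentially"
    "\<And>\<delta>. \<delta> > 0 \<Longrightarrow> \<forall>\<^sub>F N in sequentially. \<forall>\<^sub>F n in sequentially.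
       norm (a (r N)) + norm (a (r n) - a (r N)) \<le> norm (a (r n)) + \<delta>"
proof -
  obtain V where V: "finite V" "cball (0 :: 'a) 1 = convex hull V"
    using assms by (auto simp: polytope_def)
  have V_norm: "norm v \<le> 1" if "v \<in> V" for v
    using hull_inc[OF that, of convex] V(2) by (metis mem_cball_0)
  have "\<exists>c. (\<forall>v\<in>V. 0 \<le> c v) \<and> (\<Sum>v\<in>V. c v) = norm x \<and> (\<Sum>v\<in>V. c v *\<^sub>R v) = x" for x
    using norm_representation_polytope[OF V] by metis
  then obtain C where C: "\<And>x v. v \<in> V \<Longrightarrow> 0 \<le> C x v" "\<And>x. (\<Sum>v\<in>V. C x v) = norm x"
      "\<And>x. (\<Sum>v\<in>V. C x v *\<^sub>R v) = x"
    by metis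
  obtain q :: "nat \<Rightarrow> nat" where q: "strict_mono q"
    "convergent ((\<lambda>n. norm (a n)) \<circ> q) \<or> filterlim ((\<lambda>n. norm (a n)) \<circ> q) at_top sequentially"
    using convergent_or_at_top_subseq[of "\<lambda>n. norm (a n)"] by auto
  obtain p :: "nat \<Rightarrow> nat" where p: "strict_mono p"
    "\<And>v. v \<in> V \<Longrightarrow> convergent ((\<lambda>n. C (a (q n)) v) \<circ> p) \<or>
       filterlim ((\<lambda>n. C (a (q n)) v) \<circ> p) at_top sequentially"
    using convergent_or_at_top_subseq_finite[OF V(1), of "\<lambda>v n. C (a (q n)) v"] C(1) by metis
  define r where "r = q \<circ> p"
  show thesis
  proof
    show "strict_mono r"
      unfolding r_def by (rule strict_mono_o[OF q(1) p(1)])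
    show "convergent (\<lambda>n. norm (a (r n))) \<or> filterlim (\<lambda>n. norm (a (r n))) at_top sequentially"
      using q(2) convergent_subseq_convergent[OF _ p(1)]
        filterlim_compose[OF _ filterlim_subseq[OF p(1)], of "(\<lambda>n. norm (a n)) \<circ> q" at_top]
      by (auto simp: o_def r_def)
    fix \<delta> :: real assume "\<delta> > 0"
    \<comment> \<open>Each vertex will cost \<open>2 * \<eta>\<close>; the \<open>+ 1\<close> keeps
      the denominator positive without a case distinction on \<open>card V\<close>.\<close>
    define \<eta> where "\<eta> = \<delta> / (2 * (real (card V) + 1))"
    have "\<eta> > 0" using \<open>\<delta> > 0\<close> by (simp add: \<eta>_def)
    have \<eta>: "2 * (real (card V) * \<eta>) \<le> \<delta>"
      using \<open>\<delta> > 0\<close> by (simp add: \<eta>_def field_simps)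
    have "\<forall>\<^sub>F N in sequentially. \<forall>v\<in>V. \<forall>\<^sub>F n in sequentially. C (a (r N)) v - \<eta> \<le> C (a (r n)) v"
      using eventually_almost_increasing[OF p(2) \<open>\<eta> > 0\<close>] V(1)
      by (intro eventually_ball_finite) (auto simp: r_def)
    then show "\<forall>\<^sub>F N in sequentially. \<forall>\<^sub>F n in sequentially.
       norm (a (r N)) + norm (a (r n) - a (r N)) \<le> norm (a (r n)) + \<delta>"
    proof eventually_elim
      case (elim N)
      then have "\<forall>\<^sub>F n in sequentially. \<forall>v\<in>V. C (a (r N)) v - \<eta> \<le> C (a (r n)) v"
        using V(1) by (intro eventually_ball_finite) auto
      then show ?case
      proof eventually_elim
        case (elim n)
        let ?d = "\<lambda>v. C (a (r n)) v - C (a (r N)) v"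
        have "norm (a (r n) - a (r N)) = norm (\<Sum>v\<in>V. ?d v *\<^sub>R v)"
          by (simp add: scaleR_diff_left sum_subtractf C(3))
        also have "\<dots> \<le> (\<Sum>v\<in>V. \<bar>?d v\<bar>)"
          using V_norm by (intro sum_norm_le) (simp add: mult_left_le)
        \<comment> \<open>A negative \<open>?d v\<close> is at least \<open>- \<eta>\<close>, so
          changing its sign adds at most \<open>2 * \<eta>\<close>.\<close>
        also have "\<dots> \<le> (\<Sum>v\<in>V. ?d v + 2 * \<eta>)"
        proof (rule sum_mono)
          fix v assume "v \<in> V"
          with elim have "C (a (r N)) v - \<eta> \<le> C (a (r n)) v" by blast
          with \<open>\<eta> > 0\<close> show "\<bar>?d v\<bar> \<le> ?d v + 2 * \<eta>" by linarith
        qed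
        also have "\<dots> = norm (a (r n)) - norm (a (r N)) + 2 * (real (card V) * \<eta>)"
          by (simp add: sum.distrib sum_subtractf C(2))
        finally show ?case using \<eta> by linarith
      qed
    qed
  qed
qed

section \<open>Powers of the norm distance with exponent in (0,1]\<close>

text \<open>The shares \<open>s / (s + t)\<close> and \<open>t / (s + t)\<close> add up to
  \<open>1\<close>, and each is at most its own power with exponent \<open>\<alpha>\<close>.\<close>

lemma powr_subadditive:
  fixes s t \<alpha> :: real
  assumes "0 \<le> s" "0 \<le> t" "0 < \<alpha>" "\<alpha> \<le> 1"
  shows "(s + t) powr \<alpha> \<le> s powr \<alpha> + t powr \<alpha>"
proof (cases "s + t = 0")
  case True
  with assms show ?thesis by simp
next
  case False
  with assms have pos: "s + t > 0" by simp
  have *: "u / (s + t) * (s + t) powr \<alpha> \<le> u powr \<alpha>" if "0 \<le> u" "u \<le> s + t" for u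
  proof -
    have "(u / (s + t)) powr 1 \<le> (u / (s + t)) powr \<alpha>"
      using that pos assms by (intro powr_mono') auto
    then have "u / (s + t) \<le> (u / (s + t)) powr \<alpha>"
      using that pos by simp
    also have "\<dots> = u powr \<alpha> / (s + t) powr \<alpha>"
      using that pos by (simp add: powr_divide)
    finally show ?thesis
      using pos by (simp add: field_simps)
  qed
  have "(s + t) powr \<alpha> = s / (s + t) * (s + t) powr \<alpha> + t / (s + t) * (s + t) powr \<alpha>"
    using pos by (simp flip: distrib_right add_divide_distrib)
  also have "\<dots> \<le> s powr \<alpha> + t powr \<alpha>"
    using *[of s] *[of t] assms by simp
  finally show ?thesis .
qed

text \<open>A tangent bound for a concave function with the factor \<open>\<alpha>\<close> rounded
  up to \<open>1\<close>. For \<open>\<alpha> < 1\<close> it shows that a fixed shift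
  \<open>t\<close> matters less and less as \<open>s\<close> grows.\<close>

lemma powr_increment_le:
  fixes s t \<alpha> :: real
  assumes "0 < s" "0 \<le> t" "0 < \<alpha>" "\<alpha> \<le> 1"
  shows "(s + t) powr \<alpha> \<le> s powr \<alpha> + t * s powr (\<alpha> - 1)"
proof -
  have "(s + t) powr \<alpha> = s powr \<alpha> * (1 + t / s) powr \<alpha>"
    using assms powr_mult[of s "1 + t / s" \<alpha>] by (simp add: distrib_left)
  also have "\<dots> \<le> s powr \<alpha> * (1 + t / s) powr 1"
    using assms by (intro mult_left_mono powr_mono) auto
  also have "\<dots> = s powr \<alpha> + t * s powr (\<alpha> - 1)"
    using assms by (simp add: powr_diff field_simps)
  finally show ?thesis .
qed

lemma polytope_norm_powr_collinear:
  fixes a :: "nat \<Rightarrow> 'a::real_normed_vector"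
  assumes polytope: "polytope (cball (0 :: 'a) 1)" and \<alpha>: "0 < \<alpha>" "\<alpha> \<le> 1" and "\<delta> > 0"
  shows "\<exists>r :: nat \<Rightarrow> nat. strict_mono r \<and>
    ((\<exists>N. \<forall>\<^sub>F n in sequentially.
        dist x (a N) powr \<alpha> + dist (a N) (a (r n)) powr \<alpha> \<le> dist x (a (r n)) powr \<alpha> + \<delta>) \<or>
     (\<forall>y. \<forall>\<^sub>F n in sequentially. dist y (a (r n)) powr \<alpha> \<le> dist x (a (r n)) powr \<alpha> + \<delta>))"
proof -
  obtain r :: "nat \<Rightarrow> nat" where r: "strict_mono r"
    "convergent (\<lambda>n. norm (a (r n) - x)) \<or> filterlim (\<lambda>n. norm (a (r n) - x)) at_top sequentially"
    and col: "\<And>\<delta>. \<delta> > 0 \<Longrightarrow> \<forall>\<^sub>F N in sequentially. \<forall>\<^sub>F n in sequentially.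
       norm (a (r N) - x) + norm (a (r n) - x - (a (r N) - x)) \<le> norm (a (r n) - x) + \<delta>"
    by (rule polytope_norm_collinear[OF polytope, of "\<lambda>n. a n - x"]) (rule that)
  define d where "d n = dist x (a (r n))" for n
  have d: "convergent d \<or> filterlim d at_top sequentially"
    using r(2) by (simp add: d_def[abs_def] dist_norm norm_minus_commute)
  have col: "\<forall>\<^sub>F N in sequentially. \<forall>\<^sub>F n in sequentially. d N + dist (a (r N)) (a (r n)) \<le> d n + \<delta>"
    if "\<delta> > 0" for \<delta>
    using col[OF that] by (simp add: d_def dist_norm norm_minus_commute)
  \<comment> \<open>For \<open>\<alpha> < 1\<close> near additivity of the norm does not pass to
    powers. If \<open>d\<close> converges, it instead makes the tail cluster around some
    \<open>a (r N)\<close>; if \<open>d\<close> tends to infinity, the second alternative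
    holds.\<close>
  consider "\<alpha> = 1" | "convergent d" | "\<alpha> < 1" "filterlim d at_top sequentially"
    using d \<alpha> by linarith
  then show ?thesis
  proof cases
    case 1
    obtain N where "\<forall>\<^sub>F n in sequentially. d N + dist (a (r N)) (a (r n)) \<le> d n + \<delta>"
      using eventually_happens[OF col[OF \<open>\<delta> > 0\<close>]] by auto
    with 1 r(1) show ?thesis
      by (auto simp: d_def intro!: exI[of _ r] exI[of _ "r N"])
  next
    case 2
    \<comment> \<open>The distance from \<open>a (r N)\<close> to \<open>a (r n)\<close> enters
      twice, directly and through subadditivity, so its power may be at most
      \<open>\<delta> / 2\<close>. Three errors of \<open>\<eta> / 4\<close> keep the distance
      itself below \<open>\<eta>\<close>.\<close>
    define \<eta> where "\<eta> = (\<delta> / 2) powr (1 / \<alpha>)"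
    have "\<eta> > 0" and \<eta>: "\<eta> powr \<alpha> = \<delta> / 2"
      using \<open>\<delta> > 0\<close> \<alpha> by (auto simp: \<eta>_def powr_powr)
    obtain l where l: "d \<longlonglongrightarrow> l" using 2 by (auto simp: convergent_def)
    have upper: "\<forall>\<^sub>F n in sequentially. d n < l + \<eta> / 4"
      and lower: "\<forall>\<^sub>F n in sequentially. l - \<eta> / 4 < d n"
      using order_tendstoD[OF l] \<open>\<eta> > 0\<close> by auto
    have "\<eta> / 4 > 0" using \<open>\<eta> > 0\<close> by simp
    obtain N where N: "\<forall>\<^sub>F n in sequentially. d N + dist (a (r N)) (a (r n)) \<le> d n + \<eta> / 4"
      "l - \<eta> / 4 < d N"
      using eventually_happens[OF eventually_conj[OF col[OF \<open>\<eta> / 4 > 0\<close>] lower]] by auto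
    have "\<forall>\<^sub>F n in sequentially. dist x (a (r N)) powr \<alpha> + dist (a (r N)) (a (r n)) powr \<alpha>
      \<le> dist x (a (r n)) powr \<alpha> + \<delta>"
      using N(1) upper
    proof eventually_elim
      case (elim n)
      then have "dist (a (r N)) (a (r n)) \<le> \<eta>" using N(2) \<open>\<eta> > 0\<close> by linarith
      then have small: "dist (a (r N)) (a (r n)) powr \<alpha> \<le> \<delta> / 2"
        using \<alpha> powr_mono2[of \<alpha> "dist (a (r N)) (a (r n))" \<eta>] \<eta> by simp
      have "dist x (a (r N)) powr \<alpha> \<le> (dist x (a (r n)) + dist (a (r N)) (a (r n))) powr \<alpha>"
        using \<alpha> by (intro powr_mono2) (auto simp: dist_triangle2)
      also have "\<dots> \<le> dist x (a (r n)) powr \<alpha> + dist (a (r N)) (a (r n)) powr \<alpha>"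
        using \<alpha> by (intro powr_subadditive) auto
      finally show ?case using small by linarith
    qed
    with r(1) show ?thesis by blast
  next
    case 3
    \<comment> \<open>Moving the base point from \<open>x\<close> to \<open>y\<close> changes the
      distance by at most \<open>dist x y\<close>, hence raises the power by at most
      \<open>dist x y * d n powr (\<alpha> - 1)\<close>, which tends to \<open>0\<close> as the
      exponent is negative.\<close>
    have "\<forall>\<^sub>F n in sequentially. dist y (a (r n)) powr \<alpha> \<le> dist x (a (r n)) powr \<alpha> + \<delta>" for y
    proof -
      have "((\<lambda>t :: real. t powr (\<alpha> - 1)) \<longlongrightarrow> 0) at_top"
        using 3(1) by (intro tendsto_neg_powr filterlim_ident) simp
      then have "(\<lambda>n. d n powr (\<alpha> - 1)) \<longlonglongrightarrow> 0"
        using 3(2) by (rule filterlim_compose)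
      then have "(\<lambda>n. dist x y * d n powr (\<alpha> - 1)) \<longlonglongrightarrow> 0"
        by (rule tendsto_mult_right_zero)
      then have "\<forall>\<^sub>F n in sequentially. dist x y * d n powr (\<alpha> - 1) < \<delta>"
        using order_tendstoD(2) \<open>\<delta> > 0\<close> by blast
      moreover have "\<forall>\<^sub>F n in sequentially. 0 < d n"
        using 3(2) by (simp add: filterlim_at_top_dense)
      ultimately show ?thesis
      proof eventually_elim
        case (elim n)
        have "dist y (a (r n)) powr \<alpha> \<le> (d n + dist x y) powr \<alpha>"
          using \<alpha> dist_triangle3[of y "a (r n)" x]
          by (intro powr_mono2) (auto simp: d_def add.commute)
        also have "\<dots> \<le> d n powr \<alpha> + dist x y * d n powr (\<alpha> - 1)"
          using elim(2) \<alpha> by (intro powr_increment_le) auto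
        finally show ?case using elim(1) unfolding d_def by linarith
      qed
    qed
    with r(1) show ?thesis by blast
  qed
qed

text \<open>Subadditivity of the power gives the triangle inequality; the factor \<open>K\<close> is
  absorbed by using the dichotomy with error \<open>\<delta> / K\<close>.\<close>

lemma collinear_sequences_polytope_norm:
  assumes polytope: "polytope (cball (0 :: 'a::real_normed_vector) 1)"
    and \<alpha>: "0 < \<alpha>" "\<alpha> \<le> 1" and "K > 0"
  shows "collinear_sequences (\<lambda>x y :: 'a. K * dist x y powr \<alpha>)"
proof
  fix x y z :: 'a
  have "dist x z powr \<alpha> \<le> (dist x y + dist y z) powr \<alpha>"
    using \<alpha> by (intro powr_mono2) (auto simp: dist_triangle)
  also have "\<dots> \<le> dist x y powr \<alpha> + dist y z powr \<alpha>"
    using \<alpha> by (intro powr_subadditive) auto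
  finally show "K * dist x z powr \<alpha> \<le> K * dist x y powr \<alpha> + K * dist y z powr \<alpha>"
    using \<open>K > 0\<close> by (simp flip: distrib_left)
next
  fix \<delta> :: real and x and a :: "nat \<Rightarrow> 'a"
  assume "\<delta> > 0"
  have scale: "K * s + K * t \<le> K * u + \<delta> \<longleftrightarrow> s + t \<le> u + \<delta> / K"
    "K * s \<le> K * u + \<delta> \<longleftrightarrow> s \<le> u + \<delta> / K" for s t u
    using \<open>K > 0\<close> by (auto simp: field_simps)
  show "\<exists>r :: nat \<Rightarrow> nat. strict_mono r \<and>
    ((\<exists>N. \<forall>\<^sub>F n in sequentially. K * dist x (a N) powr \<alpha> + K * dist (a N) (a (r n)) powr \<alpha>
        \<le> K * dist x (a (r n)) powr \<alpha> + \<delta>) \<or>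
     (\<forall>y. \<forall>\<^sub>F n in sequentially. K * dist y (a (r n)) powr \<alpha> \<le> K * dist x (a (r n)) powr \<alpha> + \<delta>))"
    unfolding scale
    using polytope_norm_powr_collinear[OF polytope \<alpha>, of "\<delta> / K" x a] \<open>\<delta> > 0\<close> \<open>K > 0\<close> by simp
qed (simp_all add: dist_commute)

theorem corollary3p8:
  assumes finite_dim: "\<exists>B :: 'a::banach set. finite B \<and> span B = UNIV"
    and polytope_ball: "polytope (cball (0 :: 'a) 1)"
  shows "holder_ext_exponents (UNIV :: 'a set) c_space = {0<..1}"
proof -
  \<comment> \<open>Exponents outside (0,1] are excluded by definition, so only the extension
    property remains.\<close>
  have "\<exists>g. holder_map K \<alpha> UNIV c_space g \<and> (\<forall>x\<in>M. g x = f x)"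
    if \<alpha>: "0 < \<alpha>" "\<alpha> \<le> 1" and "K > 0" and f: "holder_map K \<alpha> M c_space f"
    for K \<alpha> and M :: "'a set" and f
  proof -
    interpret collinear_sequences "\<lambda>x y :: 'a. K * dist x y powr \<alpha>"
      using collinear_sequences_polytope_norm[OF polytope_ball \<alpha> \<open>K > 0\<close>] .
    show ?thesis
      using c_space_extension[of f M] f unfolding holder_map_def
      by (metis funcsetI range_subsetD)
  qed
  then show ?thesis
    by (auto simp: holder_ext_exponents_def)
qed

end
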